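(* Let $F\colon\mathbb{B}^{2L}\to\mathbb{B}^{2L}$ be the Boolean Delta-Notch system over a graph $\mathcal{G}$ as in the context. For every $y\in\mathbb{B}^{2L}$ and every fixed point $x$ of $F$ with $x\in\kappa(y)$, there is a path from $y$ to $x$ in $AD_F$.
   Context: Let $L\ge 1$ and let $\mathcal{G}$ be an undirected connected graph without loops on the vertex set $C=\{1,\dots,L\}$. For $i\in C$ let $S(i)$ be the set of neighbours of $i$ in $\mathcal{G}$. $\mathbb{B}=\{0,1\}$. States of $\mathbb{B}^{2L}$ are written $(n,d)=(n_1,\dots,n_L,d_1,\dots,d_L)$. The Boolean Delta-Notch system is $F\colon\mathbb{B}^{2L}\to\mathbb{B}^{2L}$ with $F_i(n,d)=\bigvee_{j\in S(i)}d_j$ (empty disjunction $=0$) and $F_{i+L}(n,d)=1-n_i$ for $i\in C$. The asynchronous dynamics $AD_F$ has an edge from $x$ to the state obtained by flipping coordinate $i$ whenever $F_i(x)\neq x_i$. For $x\in\mathbb{B}^{2L}$, $I\subseteq\{1,\dots,2L\}$, the subspace $x[I]$ is $\{y: y_i=x_i\ \forall i\notin I\}$. A trap space is a subspace closed under successors in $AD_F$. $\kappa(y)$ denotes the unique minimal (for inclusion) trap space containing $y$. *)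

theory Defs
  imports Main "HOL-Library.FuncSet"
begin

text \<open>Truth values represent \<open>0\<close> and \<open>1\<close>. A state of dimension \<open>N\<close> is an extensional function on
  \<open>{1..N}\<close>, so that equality of states is equality of their \<open>N\<close> coordinates.\<close>

definition states :: "nat \<Rightarrow> (nat \<Rightarrow> bool) set" where
  "states N = {1..N} \<rightarrow>\<^sub>E (UNIV :: bool set)"

definition flip :: "(nat \<Rightarrow> bool) \<Rightarrow> nat \<Rightarrow> (nat \<Rightarrow> bool)" where
  "flip x i = x(i := \<not> x i)"

definition async_dynamics ::
    "nat \<Rightarrow> ((nat \<Rightarrow> bool) \<Rightarrow> (nat \<Rightarrow> bool)) \<Rightarrow> ((nat \<Rightarrow> bool) \<times> (nat \<Rightarrow> bool)) set" where
  "async_dynamics N F = {(x, flip x i) | x i. x \<in> states N \<and> i \<in> {1..N} \<and> F x i \<noteq> x i}"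

definition subspace_at :: "nat \<Rightarrow> (nat \<Rightarrow> bool) \<Rightarrow> nat set \<Rightarrow> (nat \<Rightarrow> bool) set" where
  "subspace_at N x I = {y \<in> states N. \<forall>i \<in> {1..N} - I. y i = x i}"

definition trap_space ::
    "nat \<Rightarrow> ((nat \<Rightarrow> bool) \<Rightarrow> (nat \<Rightarrow> bool)) \<Rightarrow> (nat \<Rightarrow> bool) set \<Rightarrow> bool" where
  "trap_space N F T \<longleftrightarrow>
     (\<exists>x \<in> states N. \<exists>I \<subseteq> {1..N}. T = subspace_at N x I) \<and>
     (\<forall>u v. u \<in> T \<and> (u, v) \<in> async_dynamics N F \<longrightarrow> v \<in> T)"

definition minimal_trap_space_containing ::
    "nat \<Rightarrow> ((nat \<Rightarrow> bool) \<Rightarrow> (nat \<Rightarrow> bool)) \<Rightarrow> (nat \<Rightarrow> bool) \<Rightarrow> (nat \<Rightarrow> bool) set \<Rightarrow> bool" where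
  "minimal_trap_space_containing N F y T \<longleftrightarrow>
     trap_space N F T \<and> y \<in> T \<and>
     (\<forall>T'. trap_space N F T' \<and> y \<in> T' \<and> T' \<subseteq> T \<longrightarrow> T' = T)"

definition kappa ::
    "nat \<Rightarrow> ((nat \<Rightarrow> bool) \<Rightarrow> (nat \<Rightarrow> bool)) \<Rightarrow> (nat \<Rightarrow> bool) \<Rightarrow> (nat \<Rightarrow> bool) set" where
  "kappa N F y = (THE T. minimal_trap_space_containing N F y T)"

text \<open>An undirected graph is given by its symmetric adjacency relation.\<close>

definition connected_loopless_graph :: "nat \<Rightarrow> (nat \<times> nat) set \<Rightarrow> bool" where
  "connected_loopless_graph L E \<longleftrightarrow>
     E \<subseteq> {1..L} \<times> {1..L} \<and> sym E \<and> irrefl E \<and>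
     (\<forall>i \<in> {1..L}. \<forall>j \<in> {1..L}. (i, j) \<in> E\<^sup>*)"

definition neighbours :: "(nat \<times> nat) set \<Rightarrow> nat \<Rightarrow> nat set" where
  "neighbours E i = {j. (i, j) \<in> E}"

text \<open>Coordinate \<open>i\<close> with \<open>1 \<le> i \<le> L\<close> holds \<open>n\<^sub>i\<close> and coordinate \<open>i + L\<close> holds \<open>d\<^sub>i\<close>.\<close>

definition delta_notch ::
    "nat \<Rightarrow> (nat \<times> nat) set \<Rightarrow> (nat \<Rightarrow> bool) \<Rightarrow> (nat \<Rightarrow> bool)" where
  "delta_notch L E x =
     (\<lambda>k \<in> {1..2 * L}. if k \<le> L then (\<exists>j \<in> neighbours E k. x (j + L)) else \<not> x (k - L))"

text \<open>The definite description in \<open>kappa\<close> is well-defined.\<close>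

lemma subspace_at_eqI:
  assumes "z \<in> subspace_at N x I"
  shows "subspace_at N x I = subspace_at N z I"
  using assms by (auto simp: subspace_at_def)

lemma trap_space_Int:
  assumes "trap_space N F S" "trap_space N F T" "y \<in> S" "y \<in> T"
  shows "trap_space N F (S \<inter> T)"
proof -
  obtain a I where I: "I \<subseteq> {1..N}" "S = subspace_at N a I"
    using assms(1) by (auto simp: trap_space_def)
  obtain b J where J: "J \<subseteq> {1..N}" "T = subspace_at N b J"
    using assms(2) by (auto simp: trap_space_def)
  have "S = subspace_at N y I" "T = subspace_at N y J"
    using I J assms(3,4) subspace_at_eqI by blast+
  then have "S \<inter> T = subspace_at N y (I \<inter> J)"
    by (auto simp: subspace_at_def)
  moreover have "y \<in> states N" using assms(3) I by (simp add: subspace_at_def)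
  moreover have "I \<inter> J \<subseteq> {1..N}" using I by blast
  ultimately show ?thesis
    using assms(1,2) unfolding trap_space_def by blast
qed

lemma ex1_minimal_trap_space_containing:
  assumes y: "y \<in> states N"
  shows "\<exists>!T. minimal_trap_space_containing N F y T"
proof -
  let ?P = "\<lambda>T. trap_space N F T \<and> y \<in> T"
  have "subspace_at N y {1..N} = states N" by (auto simp: subspace_at_def)
  moreover have "v \<in> states N" if "(u, v) \<in> async_dynamics N F" for u v
    using that by (auto simp: async_dynamics_def flip_def states_def PiE_iff extensional_def)
  ultimately have full: "?P (states N)"
    using y unfolding trap_space_def by blast
  have fin: "finite (states N)" by (simp add: states_def finite_PiE)
  have sub: "T \<subseteq> states N" if "?P T" for T
    using that by (auto simp: trap_space_def subspace_at_def)
  have finP: "finite {T. ?P T}"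
    by (rule finite_subset[of _ "Pow (states N)"]) (use sub fin in auto)
  obtain M where M: "?P M" "\<And>T. ?P T \<Longrightarrow> T \<subseteq> M \<Longrightarrow> T = M"
    using finite_has_minimal[OF finP] full by blast
  show ?thesis
  proof (rule ex1I[of _ M])
    show "minimal_trap_space_containing N F y M"
      using M unfolding minimal_trap_space_containing_def by blast
    fix T assume T: "minimal_trap_space_containing N F y T"
    then have "?P (M \<inter> T)"
      using M(1) trap_space_Int unfolding minimal_trap_space_containing_def by blast
    then have "M \<inter> T = M" "M \<inter> T = T"
      using M(2) T unfolding minimal_trap_space_containing_def by blast+
    then show "T = M" by simp
  qed
qed

lemma delta_notch_states: "delta_notch L E \<in> states (2 * L) \<rightarrow> states (2 * L)"
  by (simp add: delta_notch_def states_def)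

end

theory Submission
  imports Defs
begin

text \<open>Notch levels react to delta levels only and vice versa, so a whole block of one kind can be
  updated along a path of \<open>AD\<^sub>F\<close>, its cells moving or waiting independently.

  A cell with \<open>(n, d) = (0, 1)\<close> all of whose neighbours have \<open>(n, d) = (1, 0)\<close> is locked, and so
  keeps \<open>d = 1\<close> throughout \<open>\<kappa>(y)\<close>. All other cells can switch \<open>d\<close> off: first raise \<open>d\<close> in
  cells \<open>(0, 0)\<close> next to a cell with \<open>d = 1\<close>, then raise \<open>n\<close> next to all cells with \<open>d = 1\<close>, then
  lower \<open>d\<close> wherever \<open>n = 1\<close>.

  Now \<open>d \<le> d(x)\<close>. Cells with \<open>d = 1\<close> in the fixed point \<open>x\<close> are pairwise non-adjacent, so they have
  no neighbour with \<open>d = 1\<close>: they lower \<open>n\<close> and raise \<open>d\<close>. Delta then agrees with \<open>x\<close>, and notch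
  follows.\<close>

section \<open>Asynchronous dynamics\<close>

lemma states_eqI:
  assumes "v \<in> states N" "w \<in> states N" "\<And>k. k \<in> {1..N} \<Longrightarrow> v k = w k"
  shows "v = w"
  using assms unfolding states_def by (rule PiE_ext)

lemma flip_in_states:
  assumes "v \<in> states N" "k \<in> {1..N}"
  shows "flip v k \<in> states N"
  using assms by (auto simp: flip_def states_def PiE_iff extensional_def)

lemma flip_neq_iff:
  assumes "v k \<noteq> w k"
  shows "flip v k j \<noteq> w j \<longleftrightarrow> j \<noteq> k \<and> v j \<noteq> w j"
  using assms by (auto simp: flip_def)

lemma subspace_at_self: "a \<in> states N \<Longrightarrow> a \<in> subspace_at N a I"
  by (simp add: subspace_at_def)

lemma subspace_at_in_states: "u \<in> subspace_at N a I \<Longrightarrow> u \<in> states N"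
  by (simp add: subspace_at_def)

lemma subspace_atD:
  assumes "u \<in> subspace_at N a I" "k \<in> {1..N}" "k \<notin> I"
  shows "u k = a k"
  using assms unfolding subspace_at_def by blast

lemma flip_in_subspace_at:
  assumes "u \<in> subspace_at N a I" "k \<in> {1..N}" "k \<in> I"
  shows "flip u k \<in> subspace_at N a I"
  using assms flip_in_states by (auto simp: subspace_at_def flip_def)

lemma async_dynamics_rtrancl_within_subspace:
  assumes "v \<in> subspace_at N a I" "w \<in> subspace_at N a I"
    and "\<And>u k. \<lbrakk>u \<in> subspace_at N a I; k \<in> I; v k \<noteq> w k\<rbrakk> \<Longrightarrow> F u k = w k"
  shows "(v, w) \<in> (async_dynamics N F)\<^sup>*"
  using assms
proof (induction "card {k \<in> {1..N}. v k \<noteq> w k}" arbitrary: v)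
  case 0
  have "v = w"
    by (rule states_eqI[of v N w]) (use 0 in \<open>auto simp: subspace_at_def\<close>)
  then show ?case by simp
next
  case (Suc m)
  then have "{k \<in> {1..N}. v k \<noteq> w k} \<noteq> {}"
    by (metis card.empty nat.distinct(1))
  then obtain k where k: "k \<in> {1..N}" "v k \<noteq> w k" by blast
  then have "k \<in> I"
    using Suc.prems(1,2) subspace_atD by metis
  have "F v k = w k"
    using Suc.prems(1,3) \<open>k \<in> I\<close> k(2) by blast
  then have first_step: "(v, flip v k) \<in> async_dynamics N F"
    using k subspace_at_in_states[OF Suc.prems(1)] by (auto simp: async_dynamics_def)
  have "{j \<in> {1..N}. flip v k j \<noteq> w j} = {j \<in> {1..N}. v j \<noteq> w j} - {k}"
    using flip_neq_iff[of v k w] k(2) by blast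
  then have "m = card {j \<in> {1..N}. flip v k j \<noteq> w j}"
    using Suc.hyps(2) k by simp
  moreover have "flip v k \<in> subspace_at N a I"
    using flip_in_subspace_at Suc.prems(1) k(1) \<open>k \<in> I\<close> .
  moreover have "F u j = w j"
    if "u \<in> subspace_at N a I" "j \<in> I" "flip v k j \<noteq> w j" for u j
    using that Suc.prems(3) flip_neq_iff[of v k w] k(2) by blast
  ultimately have "(flip v k, w) \<in> (async_dynamics N F)\<^sup>*"
    using Suc.hyps(1) Suc.prems(2) by blast
  with first_step show ?case by (rule converse_rtrancl_into_rtrancl)
qed

section \<open>Trap spaces\<close>

lemma trap_space_subspace_atI:
  assumes "y \<in> states N" "I \<subseteq> {1..N}"
    and "\<And>u k. \<lbrakk>u \<in> subspace_at N y I; k \<in> {1..N} - I\<rbrakk> \<Longrightarrow> F u k = y k"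
  shows "trap_space N F (subspace_at N y I)"
proof -
  have "flip u k \<in> subspace_at N y I"
    if "u \<in> subspace_at N y I" "k \<in> {1..N}" "F u k \<noteq> u k" for u k
  proof -
    have "k \<in> I"
      using assms(3) subspace_atD that by (metis DiffI)
    then show ?thesis
      using flip_in_subspace_at that(1,2) by blast
  qed
  then have "v \<in> subspace_at N y I"
    if "u \<in> subspace_at N y I" "(u, v) \<in> async_dynamics N F" for u v
    using that by (auto simp: async_dynamics_def)
  then show ?thesis
    unfolding trap_space_def using assms(1,2) by blast
qed

lemma minimal_trap_space_containing_kappa:
  assumes "y \<in> states N"
  shows "minimal_trap_space_containing N F y (kappa N F y)"
  unfolding kappa_def by (rule theI'[OF ex1_minimal_trap_space_containing[OF assms]])

lemma kappa_subset_trap_space: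
  assumes "trap_space N F T" "y \<in> T"
  shows "kappa N F y \<subseteq> T"
proof -
  have "y \<in> states N"
    using assms by (auto simp: trap_space_def subspace_at_def)
  note minimal = minimal_trap_space_containing_kappa[OF this, of F]
  then have "trap_space N F (kappa N F y \<inter> T)" "y \<in> kappa N F y \<inter> T"
    using assms trap_space_Int unfolding minimal_trap_space_containing_def by blast+
  then have "kappa N F y \<inter> T = kappa N F y"
    using minimal unfolding minimal_trap_space_containing_def by blast
  then show ?thesis by blast
qed

lemma kappa_eq_on_invariant_coordinates:
  assumes "y \<in> states N" "x \<in> kappa N F y" "K \<subseteq> {1..N}" "k \<in> K"
    and "\<And>u j. \<lbrakk>\<And>i. i \<in> K \<Longrightarrow> u i = y i; j \<in> K\<rbrakk> \<Longrightarrow> F u j = y j"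
  shows "x k = y k"
proof -
  let ?T = "subspace_at N y ({1..N} - K)"
  have T: "?T = {u \<in> states N. \<forall>i \<in> K. u i = y i}"
    using assms(3) by (auto simp: subspace_at_def)
  have "trap_space N F ?T"
  proof (rule trap_space_subspace_atI[OF assms(1)])
    fix u k
    assume "u \<in> ?T" "k \<in> {1..N} - ({1..N} - K)"
    then have "\<And>i. i \<in> K \<Longrightarrow> u i = y i" "k \<in> K" using T by blast+
    then show "F u k = y k" by (rule assms(5))
  qed simp
  moreover have "y \<in> ?T"
    using assms(1) by (rule subspace_at_self)
  ultimately have "x \<in> ?T"
    using assms(2) kappa_subset_trap_space by blast
  then show ?thesis
    using assms(4) T by blast
qed

section \<open>The Delta-Notch system\<close>

definition cell_state :: "nat \<Rightarrow> (nat \<Rightarrow> bool) \<Rightarrow> (nat \<Rightarrow> bool) \<Rightarrow> nat \<Rightarrow> bool" where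
  "cell_state L n d = (\<lambda>k \<in> {1..2 * L}. if k \<le> L then n k else d (k - L))"

lemma cell_state_in_states: "cell_state L n d \<in> states (2 * L)"
  by (simp add: cell_state_def states_def)

lemma cell_state_notch: "i \<in> {1..L} \<Longrightarrow> cell_state L n d i = n i"
  by (simp add: cell_state_def)

lemma cell_state_delta: "i \<in> {1..L} \<Longrightarrow> cell_state L n d (i + L) = d i"
  by (simp add: cell_state_def)

lemma cell_state_of_components:
  assumes "v \<in> states (2 * L)"
  shows "cell_state L v (\<lambda>i. v (i + L)) = v"
  by (rule states_eqI[OF cell_state_in_states assms]) (simp add: cell_state_def)

lemma delta_notch_notch:
  "i \<in> {1..L} \<Longrightarrow> delta_notch L E v i \<longleftrightarrow> (\<exists>j \<in> neighbours E i. v (j + L))"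
  by (simp add: delta_notch_def)

lemma delta_notch_delta:
  "i \<in> {1..L} \<Longrightarrow> delta_notch L E v (i + L) \<longleftrightarrow> \<not> v i"
  by (simp add: delta_notch_def)

lemma delta_update_path:
  assumes "\<And>i. \<lbrakk>i \<in> {1..L}; d' i \<noteq> d i\<rbrakk> \<Longrightarrow> d' i \<longleftrightarrow> \<not> n i"
  shows "(cell_state L n d, cell_state L n d') \<in> (async_dynamics (2 * L) (delta_notch L E))\<^sup>*"
proof (rule async_dynamics_rtrancl_within_subspace)
  let ?S = "subspace_at (2 * L) (cell_state L n d) ((\<lambda>i. i + L) ` {1..L})"
  show "cell_state L n d \<in> ?S"
    using cell_state_in_states by (rule subspace_at_self)
  have "cell_state L n d' k = cell_state L n d k"
    if "k \<in> {1..2 * L}" "k \<notin> (\<lambda>i. i + L) ` {1..L}" for k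
    using that by (auto simp: cell_state_def)
  then show "cell_state L n d' \<in> ?S"
    unfolding subspace_at_def using cell_state_in_states by blast
  fix u k
  assume "u \<in> ?S" "k \<in> (\<lambda>i. i + L) ` {1..L}"
    and changed: "cell_state L n d k \<noteq> cell_state L n d' k"
  then obtain i where i: "i \<in> {1..L}" "k = i + L" by blast
  have "u i = n i"
    using \<open>u \<in> ?S\<close> i(1) by (auto simp: subspace_at_def cell_state_notch)
  then show "delta_notch L E u k = cell_state L n d' k"
    using assms[of i] changed i by (auto simp: delta_notch_delta cell_state_delta)
qed

locale delta_notch_system =
  fixes L :: nat and E :: "(nat \<times> nat) set"
  assumes edges_subset: "E \<subseteq> {1..L} \<times> {1..L}"
    and sym_edges: "sym E"
begin

abbreviation AD :: "((nat \<Rightarrow> bool) \<times> (nat \<Rightarrow> bool)) set" where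
  "AD \<equiv> async_dynamics (2 * L) (delta_notch L E)"

lemma neighbour_in_cells: "j \<in> neighbours E i \<Longrightarrow> j \<in> {1..L}"
  using edges_subset by (auto simp: neighbours_def)

lemma neighbours_sym: "j \<in> neighbours E i \<Longrightarrow> i \<in> neighbours E j"
  using sym_edges by (auto simp: neighbours_def sym_def)

lemma notch_update_path:
  assumes "\<And>i. \<lbrakk>i \<in> {1..L}; n' i \<noteq> n i\<rbrakk> \<Longrightarrow> n' i \<longleftrightarrow> (\<exists>j \<in> neighbours E i. d j)"
  shows "(cell_state L n d, cell_state L n' d) \<in> AD\<^sup>*"
proof (rule async_dynamics_rtrancl_within_subspace)
  let ?S = "subspace_at (2 * L) (cell_state L n d) {1..L}"
  show "cell_state L n d \<in> ?S"
    using cell_state_in_states by (rule subspace_at_self)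
  show "cell_state L n' d \<in> ?S"
    using cell_state_in_states[of L n' d] by (auto simp: subspace_at_def cell_state_def)
  fix u i
  assume "u \<in> ?S" and i: "i \<in> {1..L}"
    and changed: "cell_state L n d i \<noteq> cell_state L n' d i"
  have "u (j + L) = d j" if "j \<in> neighbours E i" for j
    using \<open>u \<in> ?S\<close> neighbour_in_cells[OF that]
    by (auto simp: subspace_at_def cell_state_delta)
  then show "delta_notch L E u i = cell_state L n' d i"
    using assms[of i] changed i by (auto simp: delta_notch_notch cell_state_notch)
qed

definition locked :: "(nat \<Rightarrow> bool) \<Rightarrow> nat \<Rightarrow> bool" where
  "locked y i \<longleftrightarrow> \<not> y i \<and> y (i + L) \<and> (\<forall>j \<in> neighbours E i. y j \<and> \<not> y (j + L))"

lemma kappa_delta_if_locked: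
  assumes "y \<in> states (2 * L)" "x \<in> kappa (2 * L) (delta_notch L E) y"
    and "i \<in> {1..L}" "locked y i"
  shows "x (i + L)"
proof -
  let ?K = "{i, i + L} \<union> neighbours E i \<union> (\<lambda>j. j + L) ` neighbours E i"
  have "x (i + L) = y (i + L)"
  proof (rule kappa_eq_on_invariant_coordinates[OF assms(1,2), of ?K])
    show "?K \<subseteq> {1..2 * L}"
      using assms(3) by (auto dest: neighbour_in_cells)
    fix u k
    assume u: "u j = y j" if "j \<in> ?K" for j
    assume "k \<in> ?K"
    then consider (notch) "k = i" | (delta) "k = i + L"
      | (neighbour_notch) "k \<in> neighbours E i"
      | (neighbour_delta) j where "j \<in> neighbours E i" "k = j + L"
      by blast
    then show "delta_notch L E u k = y k"
    proof cases
      case notch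
      then show ?thesis using u assms(3,4) by (auto simp: delta_notch_notch locked_def)
    next
      case delta
      then show ?thesis using u assms(3,4) by (auto simp: delta_notch_delta locked_def)
    next
      case neighbour_notch
      have "u (i + L)" using u assms(4) by (simp add: locked_def)
      then show ?thesis
        using neighbour_in_cells[OF neighbour_notch] neighbours_sym[OF neighbour_notch]
          neighbour_notch assms(4)
        by (auto simp: delta_notch_notch locked_def)
    next
      case neighbour_delta
      then show ?thesis
        using u neighbour_in_cells[OF neighbour_delta(1)] assms(4)
        by (auto simp: delta_notch_delta locked_def)
    qed
  qed simp
  then show ?thesis using assms(4) by (simp add: locked_def)
qed

lemma path_to_locked_delta:
  assumes "y \<in> states (2 * L)"
  obtains n where "(y, cell_state L n (locked y)) \<in> AD\<^sup>*"
proof -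
  define d where "d = (\<lambda>i. y (i + L))"
  define raised_delta where
    "raised_delta = (\<lambda>i. d i \<or> \<not> y i \<and> (\<exists>j \<in> neighbours E i. d j))"
  define raised_notch where
    "raised_notch = (\<lambda>i. y i \<or> (\<exists>j \<in> neighbours E i. raised_delta j))"
  have locked_iff: "locked y i \<longleftrightarrow> raised_delta i \<and> \<not> raised_notch i" for i
  proof
    assume "locked y i"
    then show "raised_delta i \<and> \<not> raised_notch i"
      by (auto simp: locked_def raised_notch_def raised_delta_def d_def)
  next
    assume unlowered: "raised_delta i \<and> \<not> raised_notch i"
    then have unraised: "\<not> raised_delta j" if "j \<in> neighbours E i" for j
      using that by (auto simp: raised_notch_def)
    then have "\<not> y i" "d i"
      using unlowered by (auto simp: raised_notch_def raised_delta_def)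
    moreover have "y j \<and> \<not> d j" if "j \<in> neighbours E i" for j
      using unraised[OF that] neighbours_sym[OF that] \<open>d i\<close> by (auto simp: raised_delta_def)
    ultimately show "locked y i" by (simp add: locked_def d_def)
  qed
  have "(cell_state L y d, cell_state L y raised_delta) \<in> AD\<^sup>*"
    by (rule delta_update_path) (auto simp: raised_delta_def)
  also have "(cell_state L y raised_delta, cell_state L raised_notch raised_delta) \<in> AD\<^sup>*"
    by (rule notch_update_path) (auto simp: raised_notch_def)
  also have "(cell_state L raised_notch raised_delta, cell_state L raised_notch (locked y)) \<in> AD\<^sup>*"
    by (rule delta_update_path) (auto simp: locked_iff)
  finally show ?thesis
    using that cell_state_of_components[OF assms] by (simp add: d_def)
qed

lemma path_to_fixed_point_if_delta_le:
  assumes "x \<in> states (2 * L)" "delta_notch L E x = x"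
    and "\<And>i. \<lbrakk>i \<in> {1..L}; d i\<rbrakk> \<Longrightarrow> x (i + L)"
  shows "(cell_state L n d, x) \<in> AD\<^sup>*"
proof -
  define dx where "dx = (\<lambda>i. x (i + L))"
  have notch_iff: "x i \<longleftrightarrow> (\<exists>j \<in> neighbours E i. dx j)"
    and delta_iff: "dx i \<longleftrightarrow> \<not> x i" if "i \<in> {1..L}" for i
    using delta_notch_notch[OF that, of E x] delta_notch_delta[OF that, of E x] assms(2)
    by (auto simp: dx_def)
  have no_active_neighbour: "\<not> d j" if "i \<in> {1..L}" "dx i" "j \<in> neighbours E i" for i j
    using that assms(3) neighbour_in_cells notch_iff delta_iff unfolding dx_def by blast
  define lowered_notch where "lowered_notch = (\<lambda>i. n i \<and> \<not> dx i)"
  have "(cell_state L n d, cell_state L lowered_notch d) \<in> AD\<^sup>*"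
    by (rule notch_update_path) (use no_active_neighbour in \<open>auto simp: lowered_notch_def\<close>)
  also have "(cell_state L lowered_notch d, cell_state L lowered_notch dx) \<in> AD\<^sup>*"
    by (rule delta_update_path) (use assms(3) in \<open>auto simp: lowered_notch_def dx_def\<close>)
  also have "(cell_state L lowered_notch dx, cell_state L x dx) \<in> AD\<^sup>*"
    by (rule notch_update_path) (use notch_iff in auto)
  finally show ?thesis
    using cell_state_of_components[OF assms(1)] by (simp add: dx_def)
qed

end

theorem theorem10:
  fixes L :: nat and E :: "(nat \<times> nat) set"
    and F :: "(nat \<Rightarrow> bool) \<Rightarrow> (nat \<Rightarrow> bool)"
    and x y :: "nat \<Rightarrow> bool"
  assumes "L \<ge> 1"
    and "connected_loopless_graph L E"
    and "F = delta_notch L E"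
    and "y \<in> states (2 * L)"
    and "x \<in> states (2 * L)"
    and "F x = x"
    and "x \<in> kappa (2 * L) F y"
  shows "(y, x) \<in> (async_dynamics (2 * L) F)\<^sup>*"
proof -
  interpret delta_notch_system L E
    using assms(2) by unfold_locales (auto simp: connected_loopless_graph_def)
  have locked_le: "x (i + L)" if "i \<in> {1..L}" "locked y i" for i
    using kappa_delta_if_locked assms(3,4,7) that by blast
  obtain n where "(y, cell_state L n (locked y)) \<in> AD\<^sup>*"
    using path_to_locked_delta[OF assms(4)] .
  also have "(cell_state L n (locked y), x) \<in> AD\<^sup>*"
    using path_to_fixed_point_if_delta_le assms(3,5,6) locked_le by blast
  finally show ?thesis
    using assms(3) by simp
qed

end
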